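(* Let $M$ and $N$ be matroids on disjoint finite sets $S$ and $T$, and let $M_1=M\oplus U_{|T|,T}$. If $N'$ is any coextension of $N$ to $S\cup T$ (i.e., a matroid on $S\cup T$ with $N'/S=N$) with $r(N')=r(N)+|S|$, then the matroid intersection $M_1\wedge N'$ is a semidirect sum of $M$ and $N$.
   Context: $U_{|T|,T}$ is the free matroid on $T$ (every subset independent). For matroids $G$, $H$ on the same set $E$, the matroid union $G\vee H$ is the matroid on $E$ whose independent sets are the sets $I_G\cup I_H$ with $I_G$ independent in $G$ and $I_H$ independent in $H$; the matroid intersection is $G\wedge H=(G^*\vee H^* )^*$. A semidirect sum of matroids $M$ on $S$ and $N$ on $T$ is a matroid $K$ on $S\cup T$ with $K|S=M$ and $K/S=N$. *)

theory Defs
  imports Main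
begin

record 'a set_system =
  ground :: "'a set"
  indeps :: "'a set set"

locale matroid =
  fixes M :: "'a set_system"
  assumes finite_ground: "finite (ground M)"
    and indeps_subset: "X \<in> indeps M \<Longrightarrow> X \<subseteq> ground M"
    and empty_indep: "{} \<in> indeps M"
    and indep_mono: "X \<in> indeps M \<Longrightarrow> Y \<subseteq> X \<Longrightarrow> Y \<in> indeps M"
    and augment: "X \<in> indeps M \<Longrightarrow> Y \<in> indeps M \<Longrightarrow> card X < card Y \<Longrightarrow>
      \<exists>y \<in> Y - X. insert y X \<in> indeps M"

definition bases :: "'a set_system \<Rightarrow> 'a set set" where
  "bases M = {B \<in> indeps M. \<forall>X \<in> indeps M. B \<subseteq> X \<longrightarrow> X = B}"

definition matroid_rank :: "'a set_system \<Rightarrow> nat" where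
  "matroid_rank M = Max (card ` indeps M)"

definition free_matroid :: "'a set \<Rightarrow> 'a set_system" where
  "free_matroid E = \<lparr>ground = E, indeps = Pow E\<rparr>"

text \<open>Meaningful as a direct sum only for disjoint ground sets.\<close>
definition direct_sum :: "'a set_system \<Rightarrow> 'a set_system \<Rightarrow> 'a set_system" where
  "direct_sum M N = \<lparr>ground = ground M \<union> ground N,
     indeps = {X \<union> Y | X Y. X \<in> indeps M \<and> Y \<in> indeps N}\<rparr>"

definition dual :: "'a set_system \<Rightarrow> 'a set_system" where
  "dual M = \<lparr>ground = ground M,
     indeps = {X. \<exists>B \<in> bases M. X \<subseteq> ground M - B}\<rparr>"

definition restriction :: "'a set_system \<Rightarrow> 'a set \<Rightarrow> 'a set_system" where
  "restriction M A = \<lparr>ground = ground M \<inter> A, indeps = {X \<in> indeps M. X \<subseteq> A}\<rparr>"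

definition deletion :: "'a set_system \<Rightarrow> 'a set \<Rightarrow> 'a set_system" where
  "deletion M A = restriction M (ground M - A)"

definition contraction :: "'a set_system \<Rightarrow> 'a set \<Rightarrow> 'a set_system" where
  "contraction M A = dual (deletion (dual M) A)"

text \<open>Union and intersection are only used for matroids on a common ground set.\<close>
definition matroid_union :: "'a set_system \<Rightarrow> 'a set_system \<Rightarrow> 'a set_system" where
  "matroid_union G H = \<lparr>ground = ground G \<union> ground H,
     indeps = {X \<union> Y | X Y. X \<in> indeps G \<and> Y \<in> indeps H}\<rparr>"

definition matroid_intersection :: "'a set_system \<Rightarrow> 'a set_system \<Rightarrow> 'a set_system" where
  "matroid_intersection G H = dual (matroid_union (dual G) (dual H))"

definition coextension :: "'a set_system \<Rightarrow> 'a set_system \<Rightarrow> 'a set \<Rightarrow> bool" where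
  "coextension N' N S \<longleftrightarrow>
     matroid N' \<and> ground N' = S \<union> ground N \<and> contraction N' S = N"

definition semidirect_sum :: "'a set_system \<Rightarrow> 'a set_system \<Rightarrow> 'a set_system \<Rightarrow> bool" where
  "semidirect_sum K M N \<longleftrightarrow>
     matroid K \<and> ground K = ground M \<union> ground N \<and>
     restriction K (ground M) = M \<and> contraction K (ground M) = N"

end

theory Submission
  imports Defs
begin

text \<open>
  Put \<open>L = M\<^sub>1\<^sup>* \<or> N'\<^sup>*\<close>, so that \<open>M\<^sub>1 \<and> N' = L\<^sup>*\<close>. All elements of \<open>T\<close> are loops of \<open>M\<^sub>1\<^sup>*\<close>,
  hence \<open>L\<close> and \<open>N'\<^sup>*\<close> agree on \<open>T\<close>, where they are \<open>N\<^sup>*\<close>; this is the claim on the contraction.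
  The rank hypothesis says that \<open>N\<^sup>*\<close> and \<open>N'\<^sup>*\<close> have the same rank, so a basis of \<open>N\<^sup>*\<close> together with a
  basis of \<open>M\<^sup>*\<close> is a basis of \<open>L\<close>, and the rank of \<open>L\<close> is the sum of the ranks of \<open>M\<^sup>*\<close> and \<open>N'\<^sup>*\<close>.
  Therefore every basis of \<open>L\<close> contains a basis of \<open>M\<^sup>*\<close>, which gives the claim on the restriction.
\<close>

lemma ground_dual [simp]: "ground (dual M) = ground M"
  by (simp add: dual_def)

section \<open>Bases, rank and extension to a basis\<close>

context matroid
begin

lemma finite_indep: "X \<in> indeps M \<Longrightarrow> finite X"
  using indeps_subset finite_ground finite_subset by blast

lemma finite_indeps: "finite (indeps M)"
  using indeps_subset finite_ground by (meson PowI finite_Pow_iff finite_subset subsetI)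

lemma basis_indep: "B \<in> bases M \<Longrightarrow> B \<in> indeps M"
  by (simp add: bases_def)

lemma basis_subset: "B \<in> bases M \<Longrightarrow> B \<subseteq> ground M"
  by (simp add: basis_indep indeps_subset)

lemma card_le_basis:
  assumes "B \<in> bases M" "X \<in> indeps M"
  shows "card X \<le> card B"
proof (rule ccontr)
  assume "\<not> card X \<le> card B"
  then obtain y where "y \<in> X - B" "insert y B \<in> indeps M"
    using augment[of B X] assms basis_indep by auto
  then show False using assms(1) unfolding bases_def by blast
qed

lemma card_basis_eq_rank:
  assumes "B \<in> bases M"
  shows "card B = matroid_rank M"
  unfolding matroid_rank_def
  by (rule sym, rule Max_eqI)
    (use assms finite_indeps card_le_basis basis_indep in auto)

lemma card_indep_le_rank: "X \<in> indeps M \<Longrightarrow> card X \<le> matroid_rank M"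
  unfolding matroid_rank_def using finite_indeps by simp

text \<open>Maximality under inclusion becomes a count, so later arguments recognise bases among
  independent sets by size.\<close>

lemma basis_iff: "B \<in> bases M \<longleftrightarrow> B \<in> indeps M \<and> card B = matroid_rank M"
proof
  assume B: "B \<in> indeps M \<and> card B = matroid_rank M"
  have "X = B" if "X \<in> indeps M" "B \<subseteq> X" for X
    using that B card_indep_le_rank[of X] finite_indep[of X] card_seteq[of X B] by auto
  with B show "B \<in> bases M" unfolding bases_def by auto
qed (simp add: basis_indep card_basis_eq_rank)

text \<open>A maximal independent set between \<open>X\<close> and \<open>X \<union> B\<close> is at
  least as large as \<open>B\<close>, since otherwise augmenting it from \<open>B\<close> would stay
  in that range. The bound \<open>C \<subseteq> X \<union> B\<close> supplies the exchange needed
  for the dual.\<close>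

lemma extend_to_basis:
  assumes "X \<in> indeps M" "B \<in> bases M"
  obtains C where "C \<in> bases M" "X \<subseteq> C" "C \<subseteq> X \<union> B"
proof -
  let ?F = "{Y \<in> indeps M. X \<subseteq> Y \<and> Y \<subseteq> X \<union> B}"
  have "finite ?F" "?F \<noteq> {}" using assms finite_indeps by auto
  from finite_has_maximal[OF this] obtain C
    where C: "C \<in> ?F" and max: "\<forall>Y \<in> ?F. C \<subseteq> Y \<longrightarrow> C = Y" ..
  have "card B \<le> card C"
  proof (rule ccontr)
    assume "\<not> card B \<le> card C"
    then obtain y where y: "y \<in> B - C" "insert y C \<in> indeps M"
      using augment[of C B] C basis_indep[OF assms(2)] by auto
    then have "insert y C \<in> ?F" using C by auto
    with max have "C = insert y C" by blast
    with y show False by auto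
  qed
  then have "C \<in> bases M"
    using C assms(2) card_indep_le_rank[of C] by (auto simp: basis_iff)
  with C that show ?thesis by auto
qed

lemma ex_basis: "\<exists>B. B \<in> bases M"
  using finite_has_maximal2[OF finite_indeps empty_indep] unfolding bases_def by auto

lemma indep_extends: "X \<in> indeps M \<Longrightarrow> \<exists>B \<in> bases M. X \<subseteq> B"
  using ex_basis extend_to_basis by metis

section \<open>Duality\<close>

lemma matroid_dual: "matroid (dual M)"
proof
  fix X Y
  assume "X \<in> indeps (dual M)" "Y \<in> indeps (dual M)" and less: "card X < card Y"
  then obtain B C where B: "B \<in> bases M" "X \<subseteq> ground M - B"
    and C: "C \<in> bases M" "Y \<subseteq> ground M - C" by (auto simp: dual_def)
  have fin: "finite X" "finite Y" "finite C"
    using B C finite_ground finite_subset basis_indep finite_indep by blast+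
  have "C - X \<in> indeps M" using C(1) basis_indep indep_mono by blast
  \<comment> \<open>Both \<open>B\<close> and \<open>C - X\<close> avoid \<open>X\<close>, hence so
    does \<open>D\<close>; any element of \<open>Y - X\<close> outside \<open>D\<close> therefore
    augments \<open>X\<close>.\<close>
  then obtain D where D: "D \<in> bases M" "C - X \<subseteq> D" "D \<subseteq> (C - X) \<union> B"
    using extend_to_basis B(1) by metis
  \<comment> \<open>Otherwise \<open>D\<close> contains the disjoint sets \<open>C - X\<close> and
    \<open>Y - X\<close>. As \<open>Y\<close> avoids \<open>C\<close>, the rest of \<open>C\<close>
    lies in \<open>X - Y\<close>, which is smaller than \<open>Y - X\<close>; so \<open>D\<close>
    would be larger than \<open>C\<close>.\<close>
  have "\<not> Y - X \<subseteq> D"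
  proof
    assume sub: "Y - X \<subseteq> D"
    have "card C + card (Y - X) = card (C \<inter> X) + card ((C - X) \<union> (Y - X))"
      using C(2) fin card_Int_Diff[of C X] by (subst card_Un_disjoint) auto
    also have "\<dots> \<le> card (X - Y) + card D"
      using sub D(2) C(2) fin D(1) basis_indep finite_indep by (intro add_mono card_mono) auto
    also have "\<dots> < card (Y - X) + card C"
      using less fin D(1) C(1)
      by (simp add: card_basis_eq_rank card_less_sym_Diff)
    finally show False by simp
  qed
  then obtain y where "y \<in> Y - X" "y \<notin> D" by blast
  moreover from this have "insert y X \<subseteq> ground M - D" using B C D(3) by blast
  ultimately show "\<exists>y \<in> Y - X. insert y X \<in> indeps (dual M)"
    using D(1) by (auto simp: dual_def)
qed (use finite_ground ex_basis in \<open>auto simp: dual_def\<close>)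

text \<open>No basis properly contains another, so neither do their complements, and each complement
  is maximal in the dual.\<close>

lemma bases_dual: "bases (dual M) = (\<lambda>B. ground M - B) ` bases M"
proof (intro equalityI subsetI)
  fix X assume X: "X \<in> bases (dual M)"
  then obtain B where "B \<in> bases M" "X \<subseteq> ground M - B" by (auto simp: bases_def dual_def)
  moreover from this have "ground M - B = X" using X unfolding bases_def[of "dual M"]
    by (auto simp: dual_def)
  ultimately show "X \<in> (\<lambda>B. ground M - B) ` bases M" by auto
next
  fix X assume "X \<in> (\<lambda>B. ground M - B) ` bases M"
  then obtain B where B: "B \<in> bases M" "X = ground M - B" by auto
  have "Y = X" if "C \<in> bases M" "Y \<subseteq> ground M - C" "X \<subseteq> Y" for C Y
  proof -
    have "C \<subseteq> B" using that B basis_subset by blast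
    then have "C = B" using that(1) basis_indep[OF B(1)] unfolding bases_def by auto
    with that B show ?thesis by auto
  qed
  with B show "X \<in> bases (dual M)" unfolding bases_def[of "dual M"] by (auto simp: dual_def)
qed

lemma dual_dual: "dual (dual M) = M"
proof -
  have "(\<exists>B \<in> bases (dual M). X \<subseteq> ground M - B) \<longleftrightarrow> (\<exists>B \<in> bases M. X \<subseteq> B)" for X
    using basis_subset by (simp add: bases_dual double_diff)
  moreover have "(\<exists>B \<in> bases M. X \<subseteq> B) \<longleftrightarrow> X \<in> indeps M" for X
    using basis_indep indep_mono indep_extends by blast
  ultimately show ?thesis by (simp add: dual_def[of "dual M"])
qed

lemma rank_dual: "matroid_rank (dual M) + matroid_rank M = card (ground M)"
proof -
  obtain B where B: "B \<in> bases M" using ex_basis by blast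
  then have "ground M - B \<in> bases (dual M)" by (simp add: bases_dual)
  then have "matroid_rank (dual M) = card (ground M - B)"
    using matroid.card_basis_eq_rank[OF matroid_dual] by simp
  with B show ?thesis using finite_ground basis_subset[OF B]
    by (simp add: card_basis_eq_rank[symmetric] card_Diff_subset finite_subset card_mono)
qed

section \<open>Restriction, deletion and contraction\<close>

lemma matroid_restriction: "matroid (restriction M A)"
proof
  fix X Y assume "X \<in> indeps (restriction M A)" "Y \<in> indeps (restriction M A)" "card X < card Y"
  then show "\<exists>y \<in> Y - X. insert y X \<in> indeps (restriction M A)"
    using augment[of X Y] by (auto simp: restriction_def)
qed (use finite_ground indeps_subset empty_indep indep_mono in \<open>auto simp: restriction_def\<close>)

end

text \<open>The outer dual in the definition of contraction cancels. This turns a coextension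
  hypothesis into a statement about independent sets of the dual.\<close>

lemma deletion_dual_eq_dual_contraction:
  assumes "matroid M"
  shows "deletion (dual M) A = dual (contraction M A)"
  using assms
  by (simp add: contraction_def deletion_def matroid.dual_dual matroid.matroid_dual
      matroid.matroid_restriction)

section \<open>Matroid union\<close>

lemma disjoint_decomposition:
  assumes "matroid H" "Z \<in> indeps (matroid_union G H)"
  obtains X Y where "X \<in> indeps G" "Y \<in> indeps H" "X \<inter> Y = {}" "Z = X \<union> Y"
proof -
  obtain X Y where "X \<in> indeps G" "Y \<in> indeps H" "Z = X \<union> Y"
    using assms(2) by (auto simp: matroid_union_def)
  \<comment> \<open>The overlap is dropped from \<open>Y\<close>, so that the sizes of the two parts
    add up in later counts.\<close>
  then show ?thesis
    using that[of X "Y - X"] matroid.indep_mono[OF assms(1), of Y "Y - X"] by auto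
qed

text \<open>
  If an augmenting element of one part already lies in the other part, moving it across brings the
  decomposition \<open>A \<union> B\<close> closer to \<open>C \<union> D\<close>.
\<close>
lemma matroid_union_augment:
  assumes G: "matroid G" and H: "matroid H"
    and CD: "C \<in> indeps G" "D \<in> indeps H" "C \<inter> D = {}"
    and "A \<in> indeps G" "B \<in> indeps H" "A \<inter> B = {}" "card (A \<union> B) < card (C \<union> D)"
  shows "\<exists>y \<in> (C \<union> D) - (A \<union> B). insert y (A \<union> B) \<in> indeps (matroid_union G H)"
  using assms(6-9)
proof (induction "card (A \<inter> D) + card (B \<inter> C)" arbitrary: A B rule: less_induct)
  case less
  note fin = matroid.finite_indep[OF G less.prems(1)] matroid.finite_indep[OF H less.prems(2)]
    matroid.finite_indep[OF G CD(1)] matroid.finite_indep[OF H CD(2)]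
  have unionI: "X \<union> Y \<in> indeps (matroid_union G H)" if "X \<in> indeps G" "Y \<in> indeps H" for X Y
    using that by (auto simp: matroid_union_def)
  \<comment> \<open>Both decompositions are disjoint, so the larger union has a larger part in
    \<open>G\<close> or in \<open>H\<close>, and augmentation applies there.\<close>
  have "card A < card C \<or> card B < card D"
    using less.prems(3,4) CD(3) fin by (auto simp: card_Un_disjoint)
  then show ?case
  proof
    assume "card A < card C"
    then obtain y where y: "y \<in> C - A" "insert y A \<in> indeps G"
      using matroid.augment[OF G less.prems(1) CD(1)] by auto
    show ?thesis
    proof (cases "y \<in> B")
      case False
      with y unionI[OF y(2) less.prems(2)] show ?thesis by auto
    next
      case True
      have eq: "insert y A \<union> (B - {y}) = A \<union> B" using True by auto
      \<comment> \<open>Since \<open>y\<close> lies in \<open>C\<close>, it is outside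
        \<open>D\<close>: the first summand of the measure is unchanged, while the second loses
        \<open>y\<close>.\<close>
      have "insert y A \<inter> D = A \<inter> D" using y CD(3) by auto
      moreover have "card ((B - {y}) \<inter> C) < card (B \<inter> C)"
        using True y fin by (intro psubset_card_mono) auto
      moreover have "B - {y} \<in> indeps H" using matroid.indep_mono[OF H less.prems(2)] by blast
      ultimately show ?thesis
        using less.hyps[of "insert y A" "B - {y}"] y(2) less.prems(3,4) unfolding eq by auto
    qed
  next
    assume "card B < card D"
    then obtain y where y: "y \<in> D - B" "insert y B \<in> indeps H"
      using matroid.augment[OF H less.prems(2) CD(2)] by auto
    show ?thesis
    proof (cases "y \<in> A")
      case False
      with y unionI[OF less.prems(1) y(2)] show ?thesis by auto
    next
      case True
      have eq: "(A - {y}) \<union> insert y B = A \<union> B" using True by auto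
      have "insert y B \<inter> C = B \<inter> C" using y CD(3) by auto
      moreover have "card ((A - {y}) \<inter> D) < card (A \<inter> D)"
        using True y fin by (intro psubset_card_mono) auto
      moreover have "A - {y} \<in> indeps G" using matroid.indep_mono[OF G less.prems(1)] by blast
      ultimately show ?thesis
        using less.hyps[of "A - {y}" "insert y B"] y(2) less.prems(3,4) unfolding eq by auto
    qed
  qed
qed

lemma matroid_matroid_union:
  assumes G: "matroid G" and H: "matroid H"
  shows "matroid (matroid_union G H)"
proof
  show "finite (ground (matroid_union G H))"
    using G H by (simp add: matroid_union_def matroid.finite_ground)
  show "X \<subseteq> ground (matroid_union G H)" if "X \<in> indeps (matroid_union G H)" for X
    using that matroid.indeps_subset[OF G] matroid.indeps_subset[OF H]
    by (fastforce simp: matroid_union_def)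
  show "{} \<in> indeps (matroid_union G H)"
    using matroid.empty_indep[OF G] matroid.empty_indep[OF H] by (auto simp: matroid_union_def)
  show "Y \<in> indeps (matroid_union G H)" if X: "X \<in> indeps (matroid_union G H)" and "Y \<subseteq> X" for X Y
  proof -
    obtain A B where "A \<in> indeps G" "B \<in> indeps H" "X = A \<union> B"
      using X by (auto simp: matroid_union_def)
    moreover from this have "A \<inter> Y \<in> indeps G" "B \<inter> Y \<in> indeps H"
      using matroid.indep_mono[OF G] matroid.indep_mono[OF H] by auto
    moreover have "Y = (A \<inter> Y) \<union> (B \<inter> Y)" using that calculation by auto
    ultimately show ?thesis by (auto simp: matroid_union_def)
  qed
  show "\<exists>y \<in> Y - X. insert y X \<in> indeps (matroid_union G H)"
    if X: "X \<in> indeps (matroid_union G H)" and Y: "Y \<in> indeps (matroid_union G H)"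
      and less: "card X < card Y" for X Y
  proof -
    obtain A B where "A \<in> indeps G" "B \<in> indeps H" "A \<inter> B = {}" "X = A \<union> B"
      by (rule disjoint_decomposition[OF H X])
    moreover obtain C D where "C \<in> indeps G" "D \<in> indeps H" "C \<inter> D = {}" "Y = C \<union> D"
      by (rule disjoint_decomposition[OF H Y])
    ultimately show ?thesis using matroid_union_augment[OF G H] less by auto
  qed
qed

text \<open>The rank of a union is at most the sum of the ranks, because each independent set splits
  into one of \<open>G\<close> and one of \<open>H\<close>. Two disjoint bases attain this
  bound.\<close>

lemma matroid_union_disjoint_bases:
  assumes G: "matroid G" and H: "matroid H"
    and B: "B \<in> bases G" and C: "C \<in> bases H" and disj: "B \<inter> C = {}"
  shows "B \<union> C \<in> bases (matroid_union G H)"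
    and "matroid_rank (matroid_union G H) = matroid_rank G + matroid_rank H"
proof -
  interpret U: matroid "matroid_union G H" by (rule matroid_matroid_union[OF G H])
  have BC: "B \<union> C \<in> indeps (matroid_union G H)"
    using B C by (auto simp: bases_def matroid_union_def)
  have card: "card (B \<union> C) = matroid_rank G + matroid_rank H"
    using disj B C G H
    by (simp add: card_Un_disjoint matroid.finite_indep matroid.basis_indep
        matroid.card_basis_eq_rank)
  obtain D where D: "D \<in> bases (matroid_union G H)" using U.ex_basis by blast
  then obtain X Y where "X \<in> indeps G" "Y \<in> indeps H" "D = X \<union> Y"
    by (auto simp: bases_def matroid_union_def)
  then have "card D \<le> matroid_rank G + matroid_rank H"
    using card_Un_le[of X Y] matroid.card_indep_le_rank[OF G] matroid.card_indep_le_rank[OF H]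
    by (meson add_mono order_trans)
  then show "matroid_rank (matroid_union G H) = matroid_rank G + matroid_rank H"
    using U.card_indep_le_rank[OF BC] card D by (simp add: U.card_basis_eq_rank)
  with BC card show "B \<union> C \<in> bases (matroid_union G H)" by (simp add: U.basis_iff)
qed

text \<open>When the rank of the union equals the sum of the ranks there is no slack: both parts of
  a basis must have full size.\<close>

lemma bases_matroid_union_split:
  assumes G: "matroid G" and H: "matroid H"
    and rank: "matroid_rank (matroid_union G H) = matroid_rank G + matroid_rank H"
    and D: "D \<in> bases (matroid_union G H)"
  obtains B C where "B \<in> bases G" "C \<in> bases H" "D = B \<union> C"
proof -
  interpret U: matroid "matroid_union G H" by (rule matroid_matroid_union[OF G H])
  obtain X Y where XY: "X \<in> indeps G" "Y \<in> indeps H" "D = X \<union> Y"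
    using D by (auto simp: bases_def matroid_union_def)
  have "matroid_rank G + matroid_rank H \<le> card X + card Y"
    using card_Un_le[of X Y] U.card_basis_eq_rank[OF D] rank XY(3) by simp
  then have "X \<in> bases G" "Y \<in> bases H"
    using XY matroid.card_indep_le_rank[OF G XY(1)] matroid.card_indep_le_rank[OF H XY(2)]
    by (simp_all add: matroid.basis_iff[OF G] matroid.basis_iff[OF H])
  with that XY(3) show ?thesis by blast
qed

section \<open>Free matroids and direct sums\<close>

lemma bases_free_matroid: "bases (free_matroid E) = {E}"
  by (auto simp: bases_def free_matroid_def)

lemma matroid_free_matroid:
  assumes "finite E"
  shows "matroid (free_matroid E)"
proof
  fix X Y assume "X \<in> indeps (free_matroid E)" "Y \<in> indeps (free_matroid E)" "card X < card Y"
  moreover from this have "\<not> Y \<subseteq> X"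
    using assms card_mono[of X Y] finite_subset[of X E] by (auto simp: free_matroid_def)
  ultimately show "\<exists>y \<in> Y - X. insert y X \<in> indeps (free_matroid E)"
    by (auto simp: free_matroid_def)
qed (use assms in \<open>auto simp: free_matroid_def\<close>)

lemma direct_sum_eq_matroid_union: "direct_sum G H = matroid_union G H"
  by (simp add: direct_sum_def matroid_union_def)

text \<open>Disjoint ground sets make every pair of bases disjoint, so the rank of the union is the
  sum, and the two lemmas on bases of unions give one inclusion each.\<close>

lemma bases_direct_sum:
  assumes G: "matroid G" and H: "matroid H" and disj: "ground G \<inter> ground H = {}"
  shows "bases (direct_sum G H) = {B \<union> C | B C. B \<in> bases G \<and> C \<in> bases H}"
proof -
  have disj': "B \<inter> C = {}" if "B \<in> bases G" "C \<in> bases H" for B C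
    using that disj matroid.basis_subset[OF G] matroid.basis_subset[OF H] by blast
  obtain B C where "B \<in> bases G" "C \<in> bases H"
    using matroid.ex_basis G H by metis
  then have rank: "matroid_rank (matroid_union G H) = matroid_rank G + matroid_rank H"
    using matroid_union_disjoint_bases(2)[OF G H] disj' by simp
  show ?thesis
    unfolding direct_sum_eq_matroid_union
  proof (intro equalityI subsetI)
    fix D assume "D \<in> bases (matroid_union G H)"
    then obtain B C where "B \<in> bases G" "C \<in> bases H" "D = B \<union> C"
      by (rule bases_matroid_union_split[OF G H rank])
    then show "D \<in> {B \<union> C | B C. B \<in> bases G \<and> C \<in> bases H}" by blast
  next
    fix D assume "D \<in> {B \<union> C | B C. B \<in> bases G \<and> C \<in> bases H}"
    then obtain B C where "B \<in> bases G" "C \<in> bases H" "D = B \<union> C" by blast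
    then show "D \<in> bases (matroid_union G H)"
      by (simp add: matroid_union_disjoint_bases(1)[OF G H] disj')
  qed
qed

text \<open>Every basis of the direct sum contains \<open>T\<close>, so all elements of
  \<open>T\<close> are loops of its dual. Only \<open>indeps\<close> is compared, because the ground
  set on the left also includes \<open>T\<close>.\<close>

lemma indeps_dual_direct_sum_free:
  assumes "matroid M" "finite T" "ground M \<inter> T = {}"
  shows "indeps (dual (direct_sum M (free_matroid T))) = indeps (dual M)"
proof -
  have "bases (direct_sum M (free_matroid T)) = (\<lambda>B. B \<union> T) ` bases M"
    using assms by (subst bases_direct_sum)
      (simp_all add: matroid_free_matroid bases_free_matroid,
        auto simp: free_matroid_def)
  moreover have "ground M \<union> T - (B \<union> T) = ground M - B" for B
    using assms(3) by auto
  moreover have "ground (direct_sum M (free_matroid T)) = ground M \<union> T"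
    by (simp add: direct_sum_def free_matroid_def)
  ultimately show ?thesis by (auto simp: dual_def)
qed

section \<open>The intersection as a semidirect sum\<close>

theorem theorem2p8:
  fixes M N M\<^sub>1 N' :: "'a set_system" and S T :: "'a set"
  assumes "matroid M" and "ground M = S"
    and "matroid N" and "ground N = T"
    and "S \<inter> T = {}"
    and "M\<^sub>1 = direct_sum M (free_matroid T)"
    and "coextension N' N S"
    and "matroid_rank N' = matroid_rank N + card S"
  shows "semidirect_sum (matroid_intersection M\<^sub>1 N') M N"
proof -
  interpret M: matroid M by fact
  interpret N: matroid N by fact
  have N': "matroid N'" "ground N' = S \<union> T" "contraction N' S = N"
    using assms(4,7) by (auto simp: coextension_def)
  interpret N': matroid N' by fact
  have fin: "finite S" "finite T" using M.finite_ground N.finite_ground assms by auto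
  have M1: "matroid M\<^sub>1" "ground M\<^sub>1 = S \<union> T"
    using assms(1,2,6) fin
    by (auto simp: direct_sum_eq_matroid_union matroid_matroid_union matroid_free_matroid)
      (auto simp: matroid_union_def free_matroid_def)
  interpret M1: matroid M\<^sub>1 by fact
  have dualM1: "indeps (dual M\<^sub>1) = indeps (dual M)"
    using indeps_dual_direct_sum_free[OF assms(1)] assms fin by simp
  then have basesM1: "bases (dual M\<^sub>1) = bases (dual M)" by (simp add: bases_def)
  define L where "L = matroid_union (dual M\<^sub>1) (dual N')"
  interpret L: matroid L
    unfolding L_def by (intro matroid_matroid_union M1.matroid_dual N'.matroid_dual)
  have groundL: "ground L = S \<union> T" by (simp add: L_def matroid_union_def M1 N')
  have delN': "deletion (dual N') S = dual N"
    using deletion_dual_eq_dual_contraction[OF N'(1)] N'(3) by simp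

  \<comment> \<open>Contracting \<open>S\<close> in \<open>dual L\<close> means deleting
    \<open>S\<close> from \<open>L\<close> and dualising, so only sets avoiding \<open>S\<close>
    matter.\<close>
  have "X \<in> indeps L \<longleftrightarrow> X \<in> indeps (dual N')" if "X \<inter> S = {}" for X
  proof
    assume "X \<in> indeps L"
    then obtain A B where "A \<in> indeps (dual M)" "B \<in> indeps (dual N')" "X = A \<union> B"
      by (auto simp: L_def matroid_union_def dualM1)
    moreover from this have "A = {}"
      using \<open>X \<inter> S = {}\<close> assms(2) by (auto simp: dual_def)
    ultimately show "X \<in> indeps (dual N')" by simp
  next
    assume "X \<in> indeps (dual N')"
    then show "X \<in> indeps L"
      using matroid.empty_indep[OF M.matroid_dual]
      by (auto simp: L_def matroid_union_def dualM1)
  qed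
  then have "deletion L S = deletion (dual N') S"
    by (auto simp: deletion_def restriction_def groundL N')
  then have contr: "contraction (dual L) S = N"
    by (simp add: contraction_def L.dual_dual delN' N.dual_dual)

  have "card (S \<union> T) = card S + card T" using fin assms(5) by (simp add: card_Un_disjoint)
  \<comment> \<open>Both ranks equal \<open>card T - matroid_rank N\<close>: passing to
    \<open>N'\<close> adds \<open>card S\<close> to the ground set and to the rank alike.\<close>
  then have rank: "matroid_rank (dual N') = matroid_rank (dual N)"
    using N.rank_dual N'.rank_dual assms(4,8) N'(2) by simp
  obtain C where C: "C \<in> bases (dual N)" using matroid.ex_basis[OF N.matroid_dual] by blast
  have CT: "C \<subseteq> T" using matroid.basis_subset[OF N.matroid_dual C] assms(4) by simp
  have "C \<in> indeps (deletion (dual N') S)"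
    using C by (simp add: delN' bases_def)
  \<comment> \<open>Equal ranks make \<open>C\<close> a basis of \<open>dual N'\<close> inside
    \<open>T\<close>, hence disjoint from every basis of \<open>dual M\<close>.\<close>
  then have C': "C \<in> bases (dual N')"
    using rank matroid.card_basis_eq_rank[OF N.matroid_dual C]
    by (simp add: matroid.basis_iff[OF N'.matroid_dual] deletion_def restriction_def)
  have extend: "B \<union> C \<in> bases L"
    and rankL: "matroid_rank L = matroid_rank (dual M\<^sub>1) + matroid_rank (dual N')"
    if "B \<in> bases (dual M)" for B
  proof -
    have "B \<inter> C = {}"
      using CT matroid.basis_subset[OF M.matroid_dual that] assms(2,5) by auto
    then show "B \<union> C \<in> bases L"
      and "matroid_rank L = matroid_rank (dual M\<^sub>1) + matroid_rank (dual N')"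
      unfolding L_def
      using matroid_union_disjoint_bases[OF M1.matroid_dual N'.matroid_dual _ C'] that basesM1
      by auto
  qed
  have "X \<in> indeps (dual L) \<and> X \<subseteq> S \<longleftrightarrow> X \<in> indeps M" for X
  proof
    assume "X \<in> indeps (dual L) \<and> X \<subseteq> S"
    then obtain D where D: "D \<in> bases L" "X \<inter> D = {}" "X \<subseteq> S" by (auto simp: dual_def)
    have "matroid_rank L = matroid_rank (dual M\<^sub>1) + matroid_rank (dual N')"
      using matroid.ex_basis[OF M.matroid_dual] rankL by blast
    \<comment> \<open>Every basis \<open>D\<close> of \<open>L\<close> contains a basis
      \<open>B\<close> of \<open>dual M\<close>; as \<open>X\<close> avoids \<open>D\<close>, it
      lies in \<open>S - B\<close>, a basis of \<open>M\<close>.\<close>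
    then obtain B E where "B \<in> bases (dual M\<^sub>1)" "D = B \<union> E"
      using bases_matroid_union_split[OF M1.matroid_dual N'.matroid_dual] D(1)
      unfolding L_def by metis
    then have "X \<in> indeps (dual (dual M))"
      using D basesM1 assms(2) by (auto simp: dual_def[of "dual M"])
    then show "X \<in> indeps M" by (simp add: M.dual_dual)
  next
    assume X: "X \<in> indeps M"
    then obtain A where A: "A \<in> bases M" "X \<subseteq> A" using M.indep_extends by blast
    \<comment> \<open>This basis of \<open>L\<close> witnesses independence of \<open>X\<close> in
      \<open>dual L\<close>: its first part misses \<open>A\<close>, and \<open>C\<close> lies in
      \<open>T\<close>.\<close>
    then have "(S - A) \<union> C \<in> bases L"
      using extend[of "S - A"] assms(2) by (auto simp: M.bases_dual)
    moreover have "X \<subseteq> S" using X M.indeps_subset assms(2) by auto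
    moreover have "X \<subseteq> ground L - ((S - A) \<union> C)"
      using A CT calculation(2) assms(5) groundL by auto
    ultimately show "X \<in> indeps (dual L) \<and> X \<subseteq> S" by (auto simp: dual_def)
  qed
  then have "restriction (dual L) S = M"
    using assms(2) by (auto simp: restriction_def groundL Int_absorb1 intro!: set_system.equality)
  with contr show ?thesis
    using L.matroid_dual groundL assms(2,4)
    by (simp add: semidirect_sum_def matroid_intersection_def flip: L_def)
qed

end
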